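(* Let $0\le r\le n$ and $[\tilde n]=\{0,1,\dots,n\}$. Let $\Omega$ be the set of $\bar u\in\mathbb P(\mathbb T^{\binom{[\tilde n]}{r+1}})$ such that $u_I\ne\infty$ for some $I\ni0$ and $u_J\neq\infty$ for some $J\not\ni0$, and let $\pi:\Omega\to\mathbb P(\mathbb T^{\binom{[n]}{r}})\times\mathbb P(\mathbb T^{\binom{[n]}{r+1}})$ be $\bar u\mapsto\big(\overline{(u_{I\setminus0})_{I\ni0}},\overline{(u_I)_{I\not\ni0}}\big)$. Then $\pi$ maps $\Omega\cap Dr(r+1;n+1)$ onto $FlDr(r,r+1;n)$, and for each point $(\overline{\mu'},\overline\mu)\in FlDr(r,r+1;n)$ the fiber of $\pi|_{\Omega\cap Dr(r+1;n+1)}$ over it is the set of classes of $a\odot\mu'\oplus b\odot\mu$ with $a,b\in\mathbb R$, each of which lies in $Dr(r+1;n+1)$; this fiber is in bijection with $\mathbb R^2/\mathbb R(1,1)$. Here $\mu'$ and $\mu$ are regarded as elements of $\mathbb T^{\binom{[\tilde n]}{r+1}}$ via $\mu'(I)=\mu'(I\setminus0)$ if $0\in I$ and $\infty$ otherwise, and $\mu(J)=\mu(J)$ if $0\notin J$ and $\infty$ otherwise.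
   Context: $\mathbb T=\mathbb R\cup\{\infty\}$ with $a\odot b=a+b$, $a\oplus b=\min(a,b)$ (applied coordinatewise to vectors). $\mathbb P(\mathbb T^E)$ is $\mathbb T^E$ minus the all-$\infty$ vector, modulo $u\sim u+c\mathbf 1$, $c\in\mathbb R$; $\bar u$ is the class of $u$. "The minimum is attained at least twice" holds by convention when all entries are $\infty$. Tropical Grassmann–Plücker relations for $p\in\mathbb T^{\binom{E}{r}}$: for all $I,J\in\binom{E}{r}$ with $|I\cap J|<r-1$ and $i\in I\setminus J$, the minimum of $\{p(I)+p(J)\}\cup\{p(I\setminus i\cup j)+p(J\setminus j\cup i):j\in J\setminus I\}$ is attained at least twice. The Dressian $Dr(r+1;n+1)\subseteq\mathbb P(\mathbb T^{\binom{[\tilde n]}{r+1}})$ is the set of classes satisfying these relations (with $E=[\tilde n]$, rank $r+1$). Tropical incidence–Plücker relations for $(p,q)\in\mathbb T^{\binom{[n]}{r}}\times\mathbb T^{\binom{[n]}{s}}$, $r\le s$: for all $I'\in\binom{[n]}{r-1}$, $J'\in\binom{[n]}{s+1}$, the minimum of $\{p(I'\cup j)+q(J'\setminus j):j\in J'\setminus I'\}$ is attained at least twice. $FlDr(r,r+1;n)\subseteq\mathbb P(\mathbb T^{\binom{[n]}{r}})\times\mathbb P(\mathbb T^{\binom{[n]}{r+1}})$ is the set of $(\bar p,\bar q)$ with $p$ and $q$ satisfying their Grassmann–Plücker relations and $(p,q)$ satisfying the incidence–Plücker relations. *)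

theory Defs
  imports "HOL-Library.Extended_Real" "HOL-Library.FuncSet" "HOL-Library.Ramsey"
begin

section \<open>Tropical vectors and tropical projective space\<close>

definition trop :: "ereal set" where
  "trop = UNIV - {-\<infinity>}"

text \<open>Vectors indexed by \<open>S\<close> are extensional functions (with value \<open>undefined\<close> outside \<open>S\<close>), so
  equality of functions is equality of vectors.\<close>

definition tvec :: "'i set \<Rightarrow> ('i \<Rightarrow> ereal) set" where
  "tvec S = S \<rightarrow>\<^sub>E trop"

definition tinf :: "'i set \<Rightarrow> 'i \<Rightarrow> ereal" where
  "tinf S = (\<lambda>i\<in>S. \<infinity>)"

definition tscale :: "'i set \<Rightarrow> real \<Rightarrow> ('i \<Rightarrow> ereal) \<Rightarrow> 'i \<Rightarrow> ereal" where
  "tscale S a u = (\<lambda>i\<in>S. ereal a + u i)"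

definition tplus :: "'i set \<Rightarrow> ('i \<Rightarrow> ereal) \<Rightarrow> ('i \<Rightarrow> ereal) \<Rightarrow> 'i \<Rightarrow> ereal" where
  "tplus S u v = (\<lambda>i\<in>S. min (u i) (v i))"

definition tpoints :: "'i set \<Rightarrow> ('i \<Rightarrow> ereal) set" where
  "tpoints S = tvec S - {tinf S}"

definition tproj_rel :: "'i set \<Rightarrow> (('i \<Rightarrow> ereal) \<times> ('i \<Rightarrow> ereal)) set" where
  "tproj_rel S = {(u, v). u \<in> tpoints S \<and> v \<in> tpoints S \<and> (\<exists>c::real. v = tscale S c u)}"

definition tproj :: "'i set \<Rightarrow> ('i \<Rightarrow> ereal) set set" where
  "tproj S = tpoints S // tproj_rel S"

definition tclass :: "'i set \<Rightarrow> ('i \<Rightarrow> ereal) \<Rightarrow> ('i \<Rightarrow> ereal) set" where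
  "tclass S u = tproj_rel S `` {u}"

section \<open>Dressians and flag Dressians\<close>

definition min_attained_twice :: "'j set \<Rightarrow> ('j \<Rightarrow> ereal) \<Rightarrow> bool" where
  "min_attained_twice A f \<longleftrightarrow>
     (\<forall>a\<in>A. f a = \<infinity>) \<or> 2 \<le> card {a \<in> A. \<forall>b\<in>A. f a \<le> f b}"

text \<open>The index \<open>None\<close> stands for the term \<open>p I + p J\<close>, and \<open>Some j\<close> for the exchange with \<open>j\<close>.
  The condition \<open>card (I \<inter> J) + 1 < r\<close> is \<open>card (I \<inter> J) < r - 1\<close> without truncated subtraction.\<close>

definition grassmann_pluecker :: "'e set \<Rightarrow> nat \<Rightarrow> ('e set \<Rightarrow> ereal) \<Rightarrow> bool" where
  "grassmann_pluecker E r p \<longleftrightarrow>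
     (\<forall>I\<in>nsets E r. \<forall>J\<in>nsets E r. card (I \<inter> J) + 1 < r \<longrightarrow>
       (\<forall>i\<in>I - J. min_attained_twice (insert None (Some ` (J - I)))
          (\<lambda>k. case k of
                 None \<Rightarrow> p I + p J
               | Some j \<Rightarrow> p (I - {i} \<union> {j}) + p (J - {j} \<union> {i}))))"

text \<open>For \<open>r = 0\<close> there are no subsets of cardinality \<open>r - 1 = -1\<close>, hence no relations; the guard
  \<open>0 < r\<close> is needed because subtraction on \<open>nat\<close> truncates.\<close>

definition incidence_pluecker ::
  "'e set \<Rightarrow> nat \<Rightarrow> nat \<Rightarrow> ('e set \<Rightarrow> ereal) \<Rightarrow> ('e set \<Rightarrow> ereal) \<Rightarrow> bool" where
  "incidence_pluecker E r s p q \<longleftrightarrow>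
     (0 < r \<longrightarrow> (\<forall>I\<in>nsets E (r - 1). \<forall>J\<in>nsets E (s + 1).
       min_attained_twice (J - I) (\<lambda>j. p (I \<union> {j}) + q (J - {j}))))"

definition Dressian :: "'e set \<Rightarrow> nat \<Rightarrow> ('e set \<Rightarrow> ereal) set set" where
  "Dressian E r = {tclass (nsets E r) p | p. p \<in> tpoints (nsets E r) \<and> grassmann_pluecker E r p}"

definition FlagDressian ::
  "'e set \<Rightarrow> nat \<Rightarrow> nat \<Rightarrow> (('e set \<Rightarrow> ereal) set \<times> ('e set \<Rightarrow> ereal) set) set" where
  "FlagDressian E r s =
     {(tclass (nsets E r) p, tclass (nsets E s) q) | p q.
        p \<in> tpoints (nsets E r) \<and> q \<in> tpoints (nsets E s) \<and>
        grassmann_pluecker E r p \<and> grassmann_pluecker E s q \<and> incidence_pluecker E r s p q}"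

section \<open>The projection\<close>

definition Omega :: "nat \<Rightarrow> nat \<Rightarrow> (nat set \<Rightarrow> ereal) set set" where
  "Omega n r =
     {tclass (nsets {0..n} (r + 1)) u | u. u \<in> tpoints (nsets {0..n} (r + 1)) \<and>
        (\<exists>I\<in>nsets {0..n} (r + 1). 0 \<in> I \<and> u I \<noteq> \<infinity>) \<and>
        (\<exists>J\<in>nsets {0..n} (r + 1). 0 \<notin> J \<and> u J \<noteq> \<infinity>)}"

definition with0_part :: "nat \<Rightarrow> nat \<Rightarrow> (nat set \<Rightarrow> ereal) \<Rightarrow> nat set \<Rightarrow> ereal" where
  "with0_part n r u = (\<lambda>I\<in>nsets {1..n} r. u (insert 0 I))"

definition without0_part :: "nat \<Rightarrow> nat \<Rightarrow> (nat set \<Rightarrow> ereal) \<Rightarrow> nat set \<Rightarrow> ereal" where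
  "without0_part n r u = (\<lambda>I\<in>nsets {1..n} (r + 1). u I)"

text \<open>The image below is a singleton for every class in \<^term>\<open>Omega n r\<close>; see
  \<open>proj_pi_tclass\<close>.\<close>

definition proj_pi ::
  "nat \<Rightarrow> nat \<Rightarrow> (nat set \<Rightarrow> ereal) set \<Rightarrow> (nat set \<Rightarrow> ereal) set \<times> (nat set \<Rightarrow> ereal) set" where
  "proj_pi n r U = the_elem ((\<lambda>u. (tclass (nsets {1..n} r) (with0_part n r u),
     tclass (nsets {1..n} (r + 1)) (without0_part n r u))) ` U)"

definition extend_with0 :: "nat \<Rightarrow> nat \<Rightarrow> (nat set \<Rightarrow> ereal) \<Rightarrow> nat set \<Rightarrow> ereal" where
  "extend_with0 n r \<mu>' = (\<lambda>I\<in>nsets {0..n} (r + 1). if 0 \<in> I then \<mu>' (I - {0}) else \<infinity>)"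

definition extend_without0 :: "nat \<Rightarrow> nat \<Rightarrow> (nat set \<Rightarrow> ereal) \<Rightarrow> nat set \<Rightarrow> ereal" where
  "extend_without0 n r \<mu> = (\<lambda>J\<in>nsets {0..n} (r + 1). if 0 \<notin> J then \<mu> J else \<infinity>)"

definition trop_comb ::
  "nat \<Rightarrow> nat \<Rightarrow> real \<Rightarrow> (nat set \<Rightarrow> ereal) \<Rightarrow> real \<Rightarrow> (nat set \<Rightarrow> ereal) \<Rightarrow> nat set \<Rightarrow> ereal" where
  "trop_comb n r a \<mu>' b \<mu> =
     (let S = nsets {0..n} (r + 1)
      in tplus S (tscale S a (extend_with0 n r \<mu>')) (tscale S b (extend_without0 n r \<mu>)))"

definition diag_rel :: "((real \<times> real) \<times> (real \<times> real)) set" where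
  "diag_rel = {((a, b), (a', b')). \<exists>t. a' = a + t \<and> b' = b + t}"

section \<open>Independence of the choice of representatives\<close>

lemma ereal_shift_le_iff: "ereal c + x \<le> ereal c + y \<longleftrightarrow> x \<le> y"
  by (cases x; cases y) auto

lemma tscale_0: "u \<in> tvec S \<Longrightarrow> tscale S 0 u = u"
  unfolding tvec_def by (rule ext) (simp add: tscale_def PiE_arb[of u] zero_ereal_def[symmetric])

lemma tscale_tscale: "tscale S a (tscale S b u) = tscale S (a + b) u"
proof -
  have "ereal a + (ereal b + x) = ereal (a + b) + x" for x
    by (cases x) auto
  then show ?thesis
    by (simp add: tscale_def restrict_def fun_eq_iff del: plus_ereal.simps)
qed

lemma equiv_tproj_rel: "equiv (tpoints S) (tproj_rel S)"
proof (rule equivI)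
  show "tproj_rel S \<subseteq> tpoints S \<times> tpoints S"
    by (auto simp: tproj_rel_def)
  show "refl_on (tpoints S) (tproj_rel S)"
    by (auto simp: refl_on_def tproj_rel_def tpoints_def intro!: exI[of _ "0::real"] tscale_0[symmetric])
  show "sym (tproj_rel S)"
  proof (rule symI)
    fix u v assume "(u, v) \<in> tproj_rel S"
    then obtain c where c: "u \<in> tpoints S" "v \<in> tpoints S" "v = tscale S c u"
      by (auto simp: tproj_rel_def)
    have "u = tscale S (- c) v"
      using c by (simp add: tscale_tscale tscale_0 tpoints_def)
    with c(1,2) show "(v, u) \<in> tproj_rel S"
      by (auto simp: tproj_rel_def)
  qed
  show "trans (tproj_rel S)"
    by (rule transI) (auto simp: tproj_rel_def tscale_tscale)
qed

lemma tclass_eq_iff: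
  assumes "u \<in> tpoints S" "v \<in> tpoints S"
  shows "tclass S u = tclass S v \<longleftrightarrow> (\<exists>c. v = tscale S c u)"
  using eq_equiv_class_iff[OF equiv_tproj_rel assms] assms
  by (simp add: tclass_def tproj_rel_def)

lemma tclass_in_tproj: "u \<in> tpoints S \<Longrightarrow> tclass S u \<in> tproj S"
  by (auto simp: tclass_def tproj_def quotientI)

lemma min_attained_twice_shift:
  assumes "\<And>a. a \<in> A \<Longrightarrow> f a = ereal c + g a"
  shows "min_attained_twice A f \<longleftrightarrow> min_attained_twice A g"
proof -
  have "ereal c + x = \<infinity> \<longleftrightarrow> x = \<infinity>" for x by (cases x) auto
  moreover have "{a \<in> A. \<forall>b\<in>A. f a \<le> f b} = {a \<in> A. \<forall>b\<in>A. g a \<le> g b}"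
    using assms by (auto simp: ereal_shift_le_iff)
  ultimately show ?thesis
    using assms by (simp add: min_attained_twice_def)
qed

lemma nsets_swap:
  assumes "I \<in> nsets E r" "i \<in> I" "j \<in> E" "j \<notin> I"
  shows "I - {i} \<union> {j} \<in> nsets E r"
proof -
  have "0 < card I" using assms by (auto simp: nsets_def card_gt_0_iff)
  then show ?thesis using assms by (auto simp: nsets_def)
qed

lemma grassmann_pluecker_tscale:
  "grassmann_pluecker E r (tscale (nsets E r) c p) \<longleftrightarrow> grassmann_pluecker E r p"
proof -
  have *: "(ereal c + x) + (ereal c + y) = ereal (c + c) + (x + y)" for x y
    by (cases x; cases y) auto
  have "min_attained_twice (insert None (Some ` (J - I)))
          (\<lambda>k. case k of None \<Rightarrow> tscale (nsets E r) c p I + tscale (nsets E r) c p J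
               | Some j \<Rightarrow> tscale (nsets E r) c p (I - {i} \<union> {j}) + tscale (nsets E r) c p (J - {j} \<union> {i}))
      \<longleftrightarrow> min_attained_twice (insert None (Some ` (J - I)))
          (\<lambda>k. case k of None \<Rightarrow> p I + p J
               | Some j \<Rightarrow> p (I - {i} \<union> {j}) + p (J - {j} \<union> {i}))"
    if "I \<in> nsets E r" "J \<in> nsets E r" "i \<in> I - J" for I J i
  proof -
    have sub: "I \<subseteq> E" "J \<subseteq> E" using that by (auto simp: nsets_def)
    have sw: "I - {i} \<union> {j} \<in> nsets E r" "J - {j} \<union> {i} \<in> nsets E r" if "j \<in> J - I" for j
      using nsets_swap[OF \<open>I \<in> nsets E r\<close>, of i j] nsets_swap[OF \<open>J \<in> nsets E r\<close>, of j i]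
        \<open>i \<in> I - J\<close> that sub by auto
    show ?thesis
      by (rule min_attained_twice_shift[where c = "c + c"])
        (use that sw in \<open>auto simp: tscale_def * simp del: Un_insert_right plus_ereal.simps\<close>)
  qed
  then show ?thesis
    unfolding grassmann_pluecker_def by (meson)
qed

lemma tclass_in_Dressian_iff:
  assumes "p \<in> tpoints (nsets E r)"
  shows "tclass (nsets E r) p \<in> Dressian E r \<longleftrightarrow> grassmann_pluecker E r p"
proof
  assume "tclass (nsets E r) p \<in> Dressian E r"
  then obtain p' where p': "tclass (nsets E r) p = tclass (nsets E r) p'"
    "p' \<in> tpoints (nsets E r)" "grassmann_pluecker E r p'"
    unfolding Dressian_def by blast
  then obtain c where "p' = tscale (nsets E r) c p"
    using tclass_eq_iff[OF assms p'(2)] by blast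
  with p'(3) show "grassmann_pluecker E r p"
    by (simp only: grassmann_pluecker_tscale)
qed (use assms in \<open>unfold Dressian_def, blast\<close>)

lemma incidence_pluecker_tscale:
  assumes "r \<le> s"
  shows "incidence_pluecker E r s (tscale (nsets E r) a p) (tscale (nsets E s) b q)
    \<longleftrightarrow> incidence_pluecker E r s p q"
proof -
  have *: "(ereal a + x) + (ereal b + y) = ereal (a + b) + (x + y)" for x y
    by (cases x; cases y) auto
  have "min_attained_twice (J - I)
      (\<lambda>j. tscale (nsets E r) a p (I \<union> {j}) + tscale (nsets E s) b q (J - {j}))
    \<longleftrightarrow> min_attained_twice (J - I) (\<lambda>j. p (I \<union> {j}) + q (J - {j}))"
    if "0 < r" "I \<in> nsets E (r - 1)" "J \<in> nsets E (s + 1)" for I J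
  proof -
    have "I \<union> {j} \<in> nsets E r" "J - {j} \<in> nsets E s" if "j \<in> J - I" for j
      using that \<open>0 < r\<close> \<open>I \<in> _\<close> \<open>J \<in> _\<close> by (auto simp: nsets_def)
    then show ?thesis
      by (intro min_attained_twice_shift[where c = "a + b"])
        (auto simp: tscale_def * simp del: Un_insert_right plus_ereal.simps)
  qed
  then show ?thesis
    unfolding incidence_pluecker_def by (meson)
qed

lemma tclass_in_FlagDressian_iff:
  assumes "p \<in> tpoints (nsets E r)" "q \<in> tpoints (nsets E s)" "r \<le> s"
  shows "(tclass (nsets E r) p, tclass (nsets E s) q) \<in> FlagDressian E r s \<longleftrightarrow>
    grassmann_pluecker E r p \<and> grassmann_pluecker E s q \<and> incidence_pluecker E r s p q"
proof
  assume "(tclass (nsets E r) p, tclass (nsets E s) q) \<in> FlagDressian E r s"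
  then obtain p' q' where p': "tclass (nsets E r) p = tclass (nsets E r) p'" "p' \<in> tpoints (nsets E r)"
    and q': "tclass (nsets E s) q = tclass (nsets E s) q'" "q' \<in> tpoints (nsets E s)"
    and *: "grassmann_pluecker E r p' \<and> grassmann_pluecker E s q' \<and> incidence_pluecker E r s p' q'"
    unfolding FlagDressian_def by blast
  obtain a where "p' = tscale (nsets E r) a p"
    using tclass_eq_iff[OF assms(1) p'(2)] p'(1) by blast
  moreover obtain b where "q' = tscale (nsets E s) b q"
    using tclass_eq_iff[OF assms(2) q'(2)] q'(1) by blast
  ultimately show "grassmann_pluecker E r p \<and> grassmann_pluecker E s q \<and> incidence_pluecker E r s p q"
    using * assms(3) by (simp only: grassmann_pluecker_tscale incidence_pluecker_tscale)
qed (use assms in \<open>unfold FlagDressian_def, blast\<close>)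

lemma insert0_nsets: "I \<in> nsets {1..n::nat} r \<Longrightarrow> insert 0 I \<in> nsets {0..n} (r + 1)"
proof -
  assume "I \<in> nsets {1..n} r"
  moreover from this have "0 \<notin> I" by (force simp: nsets_def)
  ultimately show ?thesis by (auto simp: nsets_def)
qed

lemma nsets_1_subset_0: "I \<in> nsets {1..n} r \<Longrightarrow> I \<in> nsets {0..n::nat} r"
  by (auto simp: nsets_def)

lemma parts_in_tpoints:
  assumes "u \<in> tpoints (nsets {0..n} (r + 1))"
    and "\<exists>I\<in>nsets {0..n} (r + 1). 0 \<in> I \<and> u I \<noteq> \<infinity>"
    and "\<exists>J\<in>nsets {0..n} (r + 1). 0 \<notin> J \<and> u J \<noteq> \<infinity>"
  shows "with0_part n r u \<in> tpoints (nsets {1..n} r)"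
    and "without0_part n r u \<in> tpoints (nsets {1..n} (r + 1))"
proof -
  obtain I where I: "I \<in> nsets {0..n} (r + 1)" "0 \<in> I" "u I \<noteq> \<infinity>" using assms by blast
  have "I - {0} \<subseteq> {1..n}"
    using I by (force simp: nsets_def)
  then have I': "I - {0} \<in> nsets {1..n} r" "insert 0 (I - {0}) = I"
    using I by (auto simp: nsets_def)
  have "with0_part n r u (I - {0}) \<noteq> \<infinity>"
    using I I' by (simp add: with0_part_def)
  then have "with0_part n r u \<noteq> tinf (nsets {1..n} r)"
    using I' by (metis restrict_apply' tinf_def)
  then show "with0_part n r u \<in> tpoints (nsets {1..n} r)"
    using assms(1) insert0_nsets[of _ n r] unfolding tpoints_def tvec_def with0_part_def
    by (simp add: PiE_iff)
  obtain J where J: "J \<in> nsets {0..n} (r + 1)" "0 \<notin> J" "u J \<noteq> \<infinity>" using assms by blast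
  have "J \<subseteq> {1..n}"
  proof
    fix x assume "x \<in> J"
    then have "x \<noteq> 0" "x \<le> n" using J by (metis, auto simp: nsets_def)
    then show "x \<in> {1..n}" by simp
  qed
  then have J': "J \<in> nsets {1..n} (r + 1)"
    using J by (auto simp: nsets_def)
  have "without0_part n r u \<noteq> tinf (nsets {1..n} (r + 1))"
    using J J' by (metis restrict_apply' tinf_def without0_part_def)
  then show "without0_part n r u \<in> tpoints (nsets {1..n} (r + 1))"
    using assms(1) nsets_1_subset_0[of _ n "r + 1"] unfolding tpoints_def tvec_def without0_part_def
    by (simp add: PiE_iff)
qed

lemma proj_pi_tclass:
  assumes "u \<in> tpoints (nsets {0..n} (r + 1))"
    and "\<exists>I\<in>nsets {0..n} (r + 1). 0 \<in> I \<and> u I \<noteq> \<infinity>"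
    and "\<exists>J\<in>nsets {0..n} (r + 1). 0 \<notin> J \<and> u J \<noteq> \<infinity>"
  shows "proj_pi n r (tclass (nsets {0..n} (r + 1)) u) =
    (tclass (nsets {1..n} r) (with0_part n r u),
     tclass (nsets {1..n} (r + 1)) (without0_part n r u))"
proof -
  let ?S = "nsets {0..n} (r + 1)"
  let ?f = "\<lambda>u. (tclass (nsets {1..n} r) (with0_part n r u),
     tclass (nsets {1..n} (r + 1)) (without0_part n r u))"
  have eq: "?f v = ?f u" if "v \<in> tclass ?S u" for v
  proof -
    obtain c where v: "v \<in> tpoints ?S" and c: "v = tscale ?S c u"
      using \<open>v \<in> tclass ?S u\<close> by (auto simp: tclass_def tproj_rel_def)
    have nz: "ereal c + x \<noteq> \<infinity> \<longleftrightarrow> x \<noteq> \<infinity>" for x by (cases x) auto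
    have v2: "\<exists>I\<in>?S. 0 \<in> I \<and> v I \<noteq> \<infinity>" "\<exists>J\<in>?S. 0 \<notin> J \<and> v J \<noteq> \<infinity>"
      using assms(2,3) unfolding c tscale_def by (auto simp: nz)
    have "with0_part n r v = tscale (nsets {1..n} r) c (with0_part n r u)"
      "without0_part n r v = tscale (nsets {1..n} (r + 1)) c (without0_part n r u)"
      using insert0_nsets[of _ n r] nsets_1_subset_0[of _ n "r + 1"]
      by (auto simp: with0_part_def without0_part_def c tscale_def fun_eq_iff restrict_def)
    then show ?thesis
      using tclass_eq_iff[OF parts_in_tpoints(1)[OF assms] parts_in_tpoints(1)[OF v v2]]
        tclass_eq_iff[OF parts_in_tpoints(2)[OF assms] parts_in_tpoints(2)[OF v v2]]
      by auto
  qed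
  have self: "u \<in> tclass ?S u"
    using equiv_class_self[OF equiv_tproj_rel assms(1)] by (simp add: tclass_def)
  have "?f ` tclass ?S u = (\<lambda>_. ?f u) ` tclass ?S u"
    by (rule image_cong[OF refl eq])
  also have "\<dots> = {?f u}"
    by (rule image_constant[OF self])
  finally have "?f ` tclass ?S u = {?f u}" .
  then show ?thesis by (simp add: proj_pi_def)
qed

lemma proj_pi_Omega:
  "proj_pi n r \<in> Omega n r \<rightarrow> tproj (nsets {1..n} r) \<times> tproj (nsets {1..n} (r + 1))"
proof
  fix U assume "U \<in> Omega n r"
  then obtain u where U: "U = tclass (nsets {0..n} (r + 1)) u"
    and u: "u \<in> tpoints (nsets {0..n} (r + 1))"
      "\<exists>I\<in>nsets {0..n} (r + 1). 0 \<in> I \<and> u I \<noteq> \<infinity>"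
      "\<exists>J\<in>nsets {0..n} (r + 1). 0 \<notin> J \<and> u J \<noteq> \<infinity>"
    unfolding Omega_def by blast
  show "proj_pi n r U \<in> tproj (nsets {1..n} r) \<times> tproj (nsets {1..n} (r + 1))"
    unfolding U proj_pi_tclass[OF u] using parts_in_tpoints[OF u] tclass_in_tproj by blast
qed

lemma diag_rel_iff: "(x, y) \<in> diag_rel \<longleftrightarrow> fst y - fst x = snd y - snd x"
proof
  assume "(x, y) \<in> diag_rel"
  then show "fst y - fst x = snd y - snd x"
    by (auto simp: diag_rel_def)
next
  assume "fst y - fst x = snd y - snd x"
  then have "fst y = fst x + (fst y - fst x) \<and> snd y = snd x + (fst y - fst x)" by linarith
  then show "(x, y) \<in> diag_rel"
    unfolding diag_rel_def case_prod_beta mem_Collect_eq fst_conv snd_conv by (rule exI)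
qed

lemma equiv_diag_rel: "equiv UNIV diag_rel"
  by (rule equivI) (auto simp: refl_on_def sym_def trans_def diag_rel_iff)

end

theory Submission
  imports Defs
begin

text \<open>The Grassmann--Pluecker and the incidence--Pluecker relations are both exchange properties:
  for \<open>x \<in> X - Y\<close> there is \<open>y \<in> Y - X\<close> such that swapping \<open>x\<close> and \<open>y\<close> does not increase
  \<open>p X + q Y\<close>. Split \<open>u\<close> into the parts \<open>p\<close> on sets containing \<open>0\<close> and \<open>q\<close> on sets avoiding \<open>0\<close>.
  The exchange property of \<open>u\<close> restricts to those of \<open>p\<close>, of \<open>q\<close> and of the pair \<open>(p, q)\<close>. These
  three conversely cover every instance for \<open>u\<close> except those where \<open>0\<close> itself has to be swapped, or
  where a set avoiding \<open>0\<close> gives up an element to a set containing it. They do however yield the weak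
  exchange property of \<open>u\<close>, in which \<open>x\<close> may be chosen freely, and by an argument of Murota weak
  exchange implies exchange. The fibres are then read off from the two parts, each of
  which is determined up to an additive constant.\<close>

section \<open>The tropical relations as exchange properties\<close>

text \<open>A unique finite minimum is a finite entry that no other entry matches or undercuts, and
  an entry that is not minimal is undercut by a minimiser. Testing entries one at a time is what
  turns the relations into exchange properties.\<close>

lemma min_attained_twice_iff:
  assumes "finite A"
  shows "min_attained_twice A f \<longleftrightarrow> (\<forall>a\<in>A. f a \<noteq> \<infinity> \<longrightarrow> (\<exists>b\<in>A - {a}. f b \<le> f a))"
proof
  let ?M = "{a \<in> A. \<forall>b\<in>A. f a \<le> f b}"
  assume L: "min_attained_twice A f"
  show "\<forall>a\<in>A. f a \<noteq> \<infinity> \<longrightarrow> (\<exists>b\<in>A - {a}. f b \<le> f a)"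
  proof (intro ballI impI)
    fix a assume a: "a \<in> A" "f a \<noteq> \<infinity>"
    then have "2 \<le> card ?M" using L by (auto simp: min_attained_twice_def)
    then have "\<not> ?M \<subseteq> {a}" using card_mono[of "{a}" ?M] by auto
    then show "\<exists>b\<in>A - {a}. f b \<le> f a" using a by blast
  qed
next
  let ?M = "{a \<in> A. \<forall>b\<in>A. f a \<le> f b}"
  assume R: "\<forall>a\<in>A. f a \<noteq> \<infinity> \<longrightarrow> (\<exists>b\<in>A - {a}. f b \<le> f a)"
  show "min_attained_twice A f"
  proof (cases "\<forall>a\<in>A. f a = \<infinity>")
    case False
    then have "A \<noteq> {}" by auto
    then obtain a where a: "a \<in> A" "\<And>b. b \<in> A \<Longrightarrow> f a \<le> f b"
      using ex_is_arg_min_if_finite[OF assms, of f] by (auto simp: is_arg_min_linorder)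
    then have "f a \<noteq> \<infinity>" using False by force
    then obtain b where b: "b \<in> A - {a}" "f b \<le> f a" using R a by blast
    then have "{a, b} \<subseteq> ?M" using a order_trans by blast
    then have "card {a, b} \<le> card ?M" using assms by (intro card_mono) auto
    then have "2 \<le> card ?M" using b by (auto simp: card_insert_if)
    then show ?thesis by (simp add: min_attained_twice_def)
  qed (simp add: min_attained_twice_def)
qed

text \<open>For \<open>p = q\<close> and \<open>r = s\<close> this is the exchange axiom of a
  valuated matroid in the min convention; two functions and two sizes are allowed so that the
  incidence relations fit as well. The finiteness premises match the entries that
  \<open>min_attained_twice_iff\<close> ignores.\<close>

definition exchange ::
  "'e set \<Rightarrow> nat \<Rightarrow> nat \<Rightarrow> ('e set \<Rightarrow> ereal) \<Rightarrow> ('e set \<Rightarrow> ereal) \<Rightarrow> bool" where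
  "exchange E r s p q \<longleftrightarrow> (\<forall>X\<in>nsets E r. \<forall>Y\<in>nsets E s. \<forall>x\<in>X - Y. p X \<noteq> \<infinity> \<longrightarrow> q Y \<noteq> \<infinity> \<longrightarrow>
     (\<exists>y\<in>Y - X. p (insert y (X - {x})) + q (insert x (Y - {y})) \<le> p X + q Y))"

text \<open>Since \<open>x\<close> is not prescribed, each instance is symmetric in \<open>X\<close>
  and \<open>Y\<close>.\<close>

definition weak_exchange :: "'e set \<Rightarrow> nat \<Rightarrow> ('e set \<Rightarrow> ereal) \<Rightarrow> bool" where
  "weak_exchange E r u \<longleftrightarrow> (\<forall>X\<in>nsets E r. \<forall>Y\<in>nsets E r. X \<noteq> Y \<longrightarrow> u X \<noteq> \<infinity> \<longrightarrow> u Y \<noteq> \<infinity> \<longrightarrow>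
     (\<exists>x\<in>X - Y. \<exists>y\<in>Y - X. u (insert y (X - {x})) + u (insert x (Y - {y})) \<le> u X + u Y))"

lemma exchangeD:
  assumes "exchange E r s p q" "X \<in> nsets E r" "Y \<in> nsets E s" "x \<in> X" "x \<notin> Y"
    "p X \<noteq> \<infinity>" "q Y \<noteq> \<infinity>"
  obtains y where "y \<in> Y" "y \<notin> X" "p (insert y (X - {x})) + q (insert x (Y - {y})) \<le> p X + q Y"
  using assms unfolding exchange_def by blast

lemma weak_exchangeD:
  assumes "weak_exchange E r u" "X \<in> nsets E r" "Y \<in> nsets E r" "X \<noteq> Y" "u X \<noteq> \<infinity>" "u Y \<noteq> \<infinity>"
  obtains x y where "x \<in> X" "x \<notin> Y" "y \<in> Y" "y \<notin> X"
    "u (insert y (X - {x})) + u (insert x (Y - {y})) \<le> u X + u Y"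
  using assms unfolding weak_exchange_def by blast

text \<open>Swaps preserve cardinality, so only values on \<open>nsets E r\<close> and
  \<open>nsets E s\<close> enter. This allows an extensional vector to be replaced by an
  unrestricted function.\<close>

lemma exchange_cong:
  assumes "\<And>A. A \<in> nsets E r \<Longrightarrow> p A = p' A" "\<And>A. A \<in> nsets E s \<Longrightarrow> q A = q' A"
  shows "exchange E r s p q \<longleftrightarrow> exchange E r s p' q'"
proof -
  have *: "insert y (X - {x}) \<in> nsets E k"
    if "X \<in> nsets E k" "x \<in> X" "Y \<in> nsets E l" "y \<in> Y" "y \<notin> X" for x y k l X Y
    using nsets_swap[OF that(1,2), of y] that by (auto simp: nsets_def)
  have "(p (insert y (X - {x})) + q (insert x (Y - {y})) \<le> p X + q Y) =
        (p' (insert y (X - {x})) + q' (insert x (Y - {y})) \<le> p' X + q' Y)"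
    if "X \<in> nsets E r" "Y \<in> nsets E s" "x \<in> X - Y" "y \<in> Y - X" for X Y x y
    using that assms *[of X r x Y s y] *[of Y s y X r x] by auto
  then show ?thesis unfolding exchange_def using assms
    by (intro ball_cong refl) (metis (lifting))
qed

text \<open>Put \<open>I = X - {x}\<close> and \<open>J = insert x Y\<close>: the term of
  \<open>x\<close> is \<open>p X + q Y\<close>, and the term of any other \<open>j\<close> is the
  value after swapping \<open>x\<close> and \<open>j\<close>. The guard \<open>0 < r\<close> is met
  because \<open>X\<close> contains \<open>x\<close>.\<close>

lemma incidence_pluecker_iff_exchange: "incidence_pluecker E r s p q \<longleftrightarrow> exchange E r s p q"
proof
  assume L: "incidence_pluecker E r s p q"
  show "exchange E r s p q" unfolding exchange_def
  proof (intro ballI impI)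
    fix X Y x assume a: "X \<in> nsets E r" "Y \<in> nsets E s" "x \<in> X - Y" "p X \<noteq> \<infinity>" "q Y \<noteq> \<infinity>"
    then have "0 < r" "X - {x} \<in> nsets E (r - 1)" "insert x Y \<in> nsets E (s + 1)"
      by (auto simp: nsets_def card_gt_0_iff)
    then have "min_attained_twice (insert x Y - (X - {x}))
        (\<lambda>j. p ((X - {x}) \<union> {j}) + q (insert x Y - {j}))"
      using L unfolding incidence_pluecker_def by blast
    moreover have "finite (insert x Y - (X - {x}))" using a by (auto simp: nsets_def)
    moreover have e: "(X - {x}) \<union> {x} = X" "insert x Y - {x} = Y" using a by auto
    ultimately obtain y where y: "y \<in> insert x Y - (X - {x}) - {x}"
      "p ((X - {x}) \<union> {y}) + q (insert x Y - {y}) \<le> p X + q Y"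
      using a min_attained_twice_iff[of "insert x Y - (X - {x})"
          "\<lambda>j. p ((X - {x}) \<union> {j}) + q (insert x Y - {j})"]
      by (metis (no_types, lifting) DiffD2 DiffI Diff_iff ereal_plus_eq_PInfty insertCI)
    moreover have "(X - {x}) \<union> {y} = insert y (X - {x})" "insert x Y - {y} = insert x (Y - {y})"
      using y by auto
    ultimately show "\<exists>y\<in>Y - X. p (insert y (X - {x})) + q (insert x (Y - {y})) \<le> p X + q Y"
      by (intro bexI[of _ y]) auto
  qed
next
  assume R: "exchange E r s p q"
  show "incidence_pluecker E r s p q" unfolding incidence_pluecker_def
  proof (intro ballI impI)
    fix I J assume a: "0 < r" "I \<in> nsets E (r - 1)" "J \<in> nsets E (s + 1)"
    then have fin: "finite (J - I)" by (auto simp: nsets_def)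
    show "min_attained_twice (J - I) (\<lambda>j. p (I \<union> {j}) + q (J - {j}))"
      unfolding min_attained_twice_iff[OF fin]
    proof (intro ballI impI)
      fix x assume x: "x \<in> J - I" "p (I \<union> {x}) + q (J - {x}) \<noteq> \<infinity>"
      have "I \<union> {x} \<in> nsets E r" "J - {x} \<in> nsets E s"
        using a x by (auto simp: nsets_def)
      then obtain y where y: "y \<in> J - {x}" "y \<notin> I \<union> {x}"
        "p (insert y (I \<union> {x} - {x})) + q (insert x (J - {x} - {y})) \<le> p (I \<union> {x}) + q (J - {x})"
        using exchangeD[OF R, of "I \<union> {x}" "J - {x}" x] x by auto
      moreover have "insert y (I \<union> {x} - {x}) = I \<union> {y}" "insert x (J - {x} - {y}) = J - {y}"
        using x y by auto
      ultimately show "\<exists>b\<in>J - I - {x}. p (I \<union> {b}) + q (J - {b}) \<le> p (I \<union> {x}) + q (J - {x})"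
        by (intro bexI[of _ y]) auto
    qed
  qed
qed

text \<open>Both differences are singletons, so the swap merely interchanges \<open>I\<close> and
  \<open>J\<close>. Such pairs are left out of \<open>grassmann_pluecker\<close>; exchange holds for
  them with equality.\<close>

lemma nsets_exchange_trivial:
  assumes "I \<in> nsets E r" "J \<in> nsets E r" "i \<in> I - J" "\<not> card (I \<inter> J) + 1 < r"
  obtains j where "j \<in> J - I" "insert j (I - {i}) = J" "insert i (J - {j}) = I"
proof -
  have fin: "finite I" "finite J" and c: "card I = r" "card J = r" using assms by (auto simp: nsets_def)
  have "card (I - J) = card I - card (I \<inter> J)" "card (J - I) = card J - card (I \<inter> J)"
    using fin by (simp_all add: card_Diff_subset_Int Int_commute)
  moreover have "0 < card (I - J)" using fin assms by (auto simp: card_gt_0_iff)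
  ultimately have "card (I - J) = 1" "card (J - I) = 1" using c assms by linarith+
  then obtain i' j where ij: "I - J = {i'}" "J - I = {j}"
    by (auto simp: card_1_singleton_iff)
  have "i \<in> {i'}" using assms(3) ij(1) by blast
  then have ij1: "I - J = {i}" using ij(1) by simp
  show ?thesis
  proof
    show "j \<in> J - I" using ij(2) by blast
    show "insert j (I - {i}) = J" using ij1 ij(2) by blast
    show "insert i (J - {j}) = I" using ij1 ij(2) by blast
  qed
qed

text \<open>Exchange is the minimum condition tested at the \<open>None\<close> term. A term
  \<open>Some j\<close> reduces to this case by passing to the swapped pair, whose
  \<open>None\<close> term it is.\<close>

lemma grassmann_pluecker_iff_exchange: "grassmann_pluecker E r p \<longleftrightarrow> exchange E r r p p"
proof
  assume L: "grassmann_pluecker E r p"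
  show "exchange E r r p p" unfolding exchange_def
  proof (intro ballI impI)
    fix X Y x assume a: "X \<in> nsets E r" "Y \<in> nsets E r" "x \<in> X - Y" "p X \<noteq> \<infinity>" "p Y \<noteq> \<infinity>"
    show "\<exists>y\<in>Y - X. p (insert y (X - {x})) + p (insert x (Y - {y})) \<le> p X + p Y"
    proof (cases "card (X \<inter> Y) + 1 < r")
      case True
      let ?A = "insert None (Some ` (Y - X))"
      let ?f = "\<lambda>k. case k of None \<Rightarrow> p X + p Y
               | Some j \<Rightarrow> p (X - {x} \<union> {j}) + p (Y - {j} \<union> {x})"
      have "min_attained_twice ?A ?f"
        using L a True unfolding grassmann_pluecker_def by blast
      moreover have "finite ?A" using a by (auto simp: nsets_def)
      ultimately have "?f None \<noteq> \<infinity> \<longrightarrow> (\<exists>b\<in>?A - {None}. ?f b \<le> ?f None)"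
        by (simp only: min_attained_twice_iff) blast
      then show ?thesis using a by auto
    next
      case False
      then obtain y where "y \<in> Y - X" "insert y (X - {x}) = Y" "insert x (Y - {y}) = X"
        using nsets_exchange_trivial a by metis
      then show ?thesis by (intro bexI[of _ y]) (simp_all add: add.commute)
    qed
  qed
next
  assume R: "exchange E r r p p"
  show "grassmann_pluecker E r p" unfolding grassmann_pluecker_def
  proof (intro ballI impI)
    fix X Y x assume a: "X \<in> nsets E r" "Y \<in> nsets E r" "x \<in> X - Y"
    let ?A = "insert None (Some ` (Y - X))"
    let ?f = "\<lambda>k. case k of None \<Rightarrow> p X + p Y
               | Some j \<Rightarrow> p (X - {x} \<union> {j}) + p (Y - {j} \<union> {x})"
    have fin: "finite ?A" using a by (auto simp: nsets_def)
    show "min_attained_twice ?A ?f"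
      unfolding min_attained_twice_iff[OF fin]
    proof (intro ballI impI)
      fix k assume k: "k \<in> ?A" "?f k \<noteq> \<infinity>"
      show "\<exists>b\<in>?A - {k}. ?f b \<le> ?f k"
      proof (cases k)
        case None
        then obtain y where "y \<in> Y" "y \<notin> X" "p (insert y (X - {x})) + p (insert x (Y - {y})) \<le> p X + p Y"
          using exchangeD[OF R a(1,2), of x] k a by auto
        then show ?thesis using None by (intro bexI[of _ "Some y"]) auto
      next
        case (Some j)
        then have j: "j \<in> Y" "j \<notin> X" using k by auto
        let ?X = "X - {x} \<union> {j}" and ?Y = "Y - {j} \<union> {x}"
        have "?X \<in> nsets E r" "?Y \<in> nsets E r"
          using nsets_swap[OF a(1), of x j] nsets_swap[OF a(2), of j x] a j by (auto simp: nsets_def)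
        then obtain y where y: "y \<in> ?Y" "y \<notin> ?X"
          "p (insert y (?X - {j})) + p (insert j (?Y - {y})) \<le> p ?X + p ?Y"
          using exchangeD[OF R, of ?X ?Y j] k Some a j by auto
        \<comment> \<open>Moving \<open>x\<close> back undoes the swap and leads to the
          \<open>None\<close> term; any other \<open>y\<close> leads to the term
          \<open>Some y\<close>.\<close>
        show ?thesis
        proof (cases "y = x")
          case True
          have "insert y (?X - {j}) = X" "insert j (?Y - {y}) = Y" using a j True by auto
          then show ?thesis using y Some by (intro bexI[of _ None]) auto
        next
          case False
          have "insert y (?X - {j}) = X - {x} \<union> {y}" "insert j (?Y - {y}) = Y - {y} \<union> {x}"
            using a j y False by auto
          moreover have "y \<in> Y - X" "y \<noteq> j" using y False a j by auto
          ultimately show ?thesis using y Some by (intro bexI[of _ "Some y"]) auto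
        qed
      qed
    qed
  qed
qed

section \<open>From weak exchange to exchange\<close>

text \<open>Take a counterexample \<open>(X, Y, x)\<close> with \<open>X - Y\<close> as small as possible. Weak exchange brings some
  \<open>e \<noteq> x\<close> of \<open>X - Y\<close> into \<open>Y\<close> in exchange for some element. After tilting \<open>u\<close> by a linear functional
  (the potential \<open>h\<close>), under which \<open>X\<close> and \<open>X - x + v\<close> have equal value, choose the best element \<open>z\<close>
  to trade for \<open>e\<close>. Weak exchange at distance two shows that \<open>(X, Y - z + e, x)\<close> is
  a smaller counterexample.\<close>

lemma exchange_of_weak_exchange:
  assumes weak: "weak_exchange E r u"
    and trop: "\<And>X. X \<in> nsets E r \<Longrightarrow> u X \<noteq> -\<infinity>"
  shows "exchange E r r u u"
proof -
  have swap: "insert y (X - {x}) \<in> nsets E r"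
    if "X \<in> nsets E r" "Y \<in> nsets E r" "x \<in> X" "y \<in> Y" "y \<notin> X" for X Y x y
    using nsets_swap[OF that(1,3), of y] that by (auto simp: nsets_def)
  have "\<exists>v\<in>Y - X. u (insert v (X - {x})) + u (insert x (Y - {v})) \<le> u X + u Y"
    if "X \<in> nsets E r" "Y \<in> nsets E r" "x \<in> X - Y" "u X \<noteq> \<infinity>" "u Y \<noteq> \<infinity>" for X Y x
    using that
  \<comment> \<open>\<open>X\<close> and \<open>x\<close> stay fixed while \<open>Y\<close> moves
    towards \<open>X\<close>.\<close>
  proof (induction "card (X - Y)" arbitrary: Y rule: less_induct)
    case (less Y)
    note X = less.prems(1) and Y = less.prems(2) and x = less.prems(3)
    obtain a where a: "u X = ereal a" using trop[OF X] less.prems by (cases "u X") auto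
    obtain b where b: "u Y = ereal b" using trop[OF Y] less.prems by (cases "u Y") auto
    have fin: "finite X" "finite Y" using X Y by (auto simp: nsets_def)
    show ?case
    proof (rule ccontr)
      assume "\<not> ?case"
      then have bad: "ereal (a + b) < u (insert v (X - {x})) + u (insert x (Y - {v}))"
        if "v \<in> Y - X" for v using that a b by (auto simp: not_le)
      have "X \<noteq> Y" using x by auto
      then obtain e y where e: "e \<in> X" "e \<notin> Y" and y: "y \<in> Y" "y \<notin> X"
        and ey: "u (insert y (X - {e})) + u (insert e (Y - {y})) \<le> u X + u Y"
        using weak_exchangeD[OF weak X Y _ less.prems(4,5)] by metis
      \<comment> \<open>For \<open>e = x\<close> the weak exchange would be one of the swaps that
        \<open>bad\<close> forbids.\<close>
      have ex: "e \<noteq> x" using ey bad[of y] y a b by (auto simp: not_le)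
      have ey_fin: "u (insert e (Y - {y})) \<noteq> \<infinity>" using ey a b by auto
      \<comment> \<open>The second branch only has to make \<open>h2\<close> true.\<close>
      define h where "h v = (if u (insert v (X - {x})) \<noteq> \<infinity>
          then real_of_ereal (u (insert v (X - {x}))) - a
          else 1 + b - real_of_ereal (u (insert x (Y - {v}))))" for v
      have h1: "u (insert v (X - {x})) = ereal (h v + a)"
        if "v \<in> Y - X" "u (insert v (X - {x})) \<noteq> \<infinity>" for v
        using that trop[OF swap[OF X Y, of x v]] x by (cases "u (insert v (X - {x}))") (auto simp: h_def)
      \<comment> \<open>When \<open>u (X - x + v)\<close> is finite, \<open>h v\<close> is its
        excess over \<open>u X\<close>. Thus the failure of exchange becomes a condition on the
        neighbours of \<open>Y\<close> alone.\<close>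
      have h2: "ereal b < u (insert x (Y - {v})) + ereal (h v)" if v: "v \<in> Y - X" for v
      proof (cases "u (insert v (X - {x})) = \<infinity>")
        case True
        then show ?thesis using trop[OF swap[OF Y X, of v x]] x v
          by (cases "u (insert x (Y - {v}))") (auto simp: h_def)
      next
        case False
        then show ?thesis using bad[OF v] h1[OF v False]
          by (cases "u (insert x (Y - {v}))") auto
      qed
      \<comment> \<open>\<open>?g v\<close> is the tilted value of \<open>Y - v + e\<close>; it is
        finite at \<open>y\<close>, hence also at the minimiser \<open>z\<close>.\<close>
      let ?g = "\<lambda>v. u (insert e (Y - {v})) + ereal (h v)"
      obtain z where z: "z \<in> Y - X" and zmin: "\<And>v. v \<in> Y - X \<Longrightarrow> ?g z \<le> ?g v"
        using ex_is_arg_min_if_finite[of "Y - X" ?g] fin y by (auto simp: is_arg_min_linorder)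
      let ?Z = "insert e (Y - {z})"
      have Z: "?Z \<in> nsets E r" using swap[OF Y X, of z e] z e by auto
      have "?g z \<noteq> \<infinity>" using zmin[of y] y ey_fin by auto
      then obtain c where c: "u ?Z = ereal c" using trop[OF Z] by (cases "u ?Z") auto
      have "X - ?Z = (X - Y) - {e}" using z e by auto
      then have "card (X - ?Z) < card (X - Y)" using fin e
        by (metis DiffI card_Diff1_less finite_Diff)
      \<comment> \<open>The induction hypothesis supplies a swap of \<open>x\<close> and some
        \<open>v\<close> for the pair \<open>X\<close>, \<open>?Z\<close>; the rest derives a
        contradiction from it.\<close>
      from less.hyps[OF this X Z _ less.prems(4)] c x ex obtain v where
        v: "v \<in> ?Z - X" and vle: "u (insert v (X - {x})) + u (insert x (?Z - {v})) \<le> ereal (a + c)"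
        using a by auto
      have vY: "v \<in> Y - X" "v \<noteq> z" using v e by auto
      let ?W = "insert x (?Z - {v})"
      have W: "?W \<in> nsets E r" using swap[OF Z X, of v x] v x ex by auto
      have "u (insert v (X - {x})) \<noteq> \<infinity>" using vle by auto
      note hv = h1[OF vY(1) this]
      obtain d where d: "u ?W = ereal d" using trop[OF W] vle by (cases "u ?W") auto
      \<comment> \<open>By \<open>hv\<close> the first summand of \<open>vle\<close> is
        \<open>h v + a\<close>, and \<open>a\<close> cancels.\<close>
      have dc: "h v + d \<le> c" using vle hv d by auto
      \<comment> \<open>\<open>?W\<close> is \<open>Y\<close> with \<open>z\<close>,
        \<open>v\<close> replaced by \<open>x\<close>, \<open>e\<close>. Of the four possible swaps
        between them, two yield the sets \<open>?Z\<close>, \<open>Y - v + x\<close> and two yield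
        \<open>Y - v + e\<close>, \<open>Y - z + x\<close>.\<close>
      have "?W \<noteq> Y" using x by auto
      then obtain s t where s: "s \<in> ?W" "s \<notin> Y" and t: "t \<in> Y" "t \<notin> ?W"
        and st: "u (insert t (?W - {s})) + u (insert s (Y - {t})) \<le> u ?W + u Y"
        using weak_exchangeD[OF weak W Y] b d by (metis PInfty_neq_ereal(1))
      have st_cases: "s = x \<or> s = e" "t = z \<or> t = v" using s t by auto
      have W_swaps:
        "insert z (?W - {x}) = insert e (Y - {v})" "insert v (?W - {x}) = ?Z"
        "insert z (?W - {e}) = insert x (Y - {v})" "insert v (?W - {e}) = insert x (Y - {z})"
        using x e z vY ex by auto
      have "u ?Z + u (insert x (Y - {v})) \<le> ereal (d + b) \<or>
          u (insert e (Y - {v})) + u (insert x (Y - {z})) \<le> ereal (d + b)"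
        using st_cases st unfolding d b
        by (elim disjE) (simp_all only: W_swaps plus_ereal.simps add.commute simp_thms)
      then show False
      proof
        \<comment> \<open>With \<open>dc\<close> the tilted value of \<open>Y - v + x\<close> is at
          most \<open>b\<close>, against \<open>h2\<close> at \<open>v\<close>.\<close>
        assume 1: "u ?Z + u (insert x (Y - {v})) \<le> ereal (d + b)"
        from this show False using h2[OF vY(1)] c dc by (cases "u (insert x (Y - {v}))") auto
      next
        \<comment> \<open>Minimality of \<open>z\<close> bounds \<open>u (Y - v + e)\<close> below
          by \<open>c + h z - h v\<close>; with \<open>dc\<close> this contradicts \<open>h2\<close>
          at \<open>z\<close>.\<close>
        assume 2: "u (insert e (Y - {v})) + u (insert x (Y - {z})) \<le> ereal (d + b)"
        from this show False using h2[OF z] zmin[OF vY(1)] c dc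
          by (cases "u (insert x (Y - {z}))"; cases "u (insert e (Y - {v}))") auto
      qed
    qed
  qed
  then show ?thesis unfolding exchange_def by blast
qed


section \<open>Adjoining an element to the ground set\<close>

lemma nsets_insert_iff:
  assumes "e \<notin> E"
  shows "X \<in> nsets (insert e E) (Suc r) \<longleftrightarrow>
    (if e \<in> X then X - {e} \<in> nsets E r else X \<in> nsets E (Suc r))"
proof (cases "finite X")
  case True
  then have "e \<in> X \<Longrightarrow> card X = Suc (card (X - {e}))" by (rule card.remove)
  then show ?thesis using assms True by (auto simp: nsets_def simp del: card_Diff_insert)
qed (simp add: nsets_def)

text \<open>From left to right, a set containing \<open>e\<close> never receives \<open>e\<close> in
  a swap, so \<open>e\<close> can be deleted from the instances. From right to left only weak
  exchange is checked directly: its symmetry reduces the pairs with \<open>e\<close> in just one set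
  to those with \<open>e\<close> in the first, where \<open>pu\<close> applies.\<close>

lemma exchange_insert_iff:
  assumes e: "e \<notin> E"
    and trop: "\<And>X. X \<in> nsets (insert e E) (r + 1) \<Longrightarrow> u X \<noteq> -\<infinity>"
  defines "p \<equiv> \<lambda>A. u (insert e A)"
  shows "exchange (insert e E) (r + 1) (r + 1) u u \<longleftrightarrow>
    exchange E r r p p \<and> exchange E (r + 1) (r + 1) u u \<and> exchange E r (r + 1) p u"
proof
  let ?E = "insert e E"
  have nin: "e \<notin> A" if "A \<in> nsets E k" for A k using that e by (auto simp: nsets_def)
  have ins: "insert e A \<in> nsets ?E (r + 1)" if "A \<in> nsets E r" for A
    using that nin[OF that] by (auto simp: nsets_insert_iff[OF e])
  have sub: "A \<in> nsets ?E k" if "A \<in> nsets E k" for A k using that by (auto simp: nsets_def)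
  assume L: "exchange ?E (r + 1) (r + 1) u u"
  show "exchange E r r p p \<and> exchange E (r + 1) (r + 1) u u \<and> exchange E r (r + 1) p u"
  proof (intro conjI)
    show "exchange E (r + 1) (r + 1) u u"
      unfolding exchange_def using L[unfolded exchange_def, rule_format, OF sub sub] by auto
    show "exchange E r r p p" unfolding exchange_def
    proof (intro ballI impI)
      fix X Y x assume a: "X \<in> nsets E r" "Y \<in> nsets E r" "x \<in> X - Y" "p X \<noteq> \<infinity>" "p Y \<noteq> \<infinity>"
      have xe: "x \<noteq> e" using a nin by blast
      then obtain y where y: "y \<in> insert e Y" "y \<notin> insert e X"
        "u (insert y (insert e X - {x})) + u (insert x (insert e Y - {y}))
           \<le> u (insert e X) + u (insert e Y)"
        using exchangeD[OF L ins[OF a(1)] ins[OF a(2)], of x] a by (auto simp: p_def)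
      \<comment> \<open>\<open>y \<notin> insert e X\<close> excludes \<open>y = e\<close>, so
        \<open>y\<close> lies in \<open>Y\<close> and \<open>e\<close> stays in both sets.\<close>
      have "insert y (insert e X - {x}) = insert e (insert y (X - {x}))"
        "insert x (insert e Y - {y}) = insert e (insert x (Y - {y}))" using y xe by auto
      then show "\<exists>y\<in>Y - X. p (insert y (X - {x})) + p (insert x (Y - {y})) \<le> p X + p Y"
        using y by (intro bexI[of _ y]) (auto simp: p_def)
    qed
    show "exchange E r (r + 1) p u" unfolding exchange_def
    proof (intro ballI impI)
      fix X Y x assume a: "X \<in> nsets E r" "Y \<in> nsets E (r + 1)" "x \<in> X - Y" "p X \<noteq> \<infinity>" "u Y \<noteq> \<infinity>"
      have xe: "x \<noteq> e" using a nin by blast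
      then obtain y where y: "y \<in> Y" "y \<notin> insert e X"
        "u (insert y (insert e X - {x})) + u (insert x (Y - {y})) \<le> u (insert e X) + u Y"
        using exchangeD[OF L ins[OF a(1)] sub[OF a(2)], of x] a by (auto simp: p_def)
      have "insert y (insert e X - {x}) = insert e (insert y (X - {x}))" using xe by auto
      then show "\<exists>y\<in>Y - X. p (insert y (X - {x})) + u (insert x (Y - {y})) \<le> p X + u Y"
        using y by (intro bexI[of _ y]) (auto simp: p_def)
    qed
  qed
next
  let ?E = "insert e E"
  let ?P = "\<lambda>X Y. \<exists>x\<in>X - Y. \<exists>y\<in>Y - X. u (insert y (X - {x})) + u (insert x (Y - {y})) \<le> u X + u Y"
  have sym: "?P Y X" if "?P X Y" for X Y
    using that by (metis add.commute)
  assume "exchange E r r p p \<and> exchange E (r + 1) (r + 1) u u \<and> exchange E r (r + 1) p u"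
  then have pp: "exchange E r r p p" and uu: "exchange E (r + 1) (r + 1) u u"
    and pu: "exchange E r (r + 1) p u" by auto
  have mixed: "?P X Y" if a: "X \<in> nsets ?E (r + 1)" "Y \<in> nsets ?E (r + 1)" "u X \<noteq> \<infinity>" "u Y \<noteq> \<infinity>"
    "e \<in> X" "e \<notin> Y" for X Y
  proof (cases "X - {e} \<subseteq> Y")
    \<comment> \<open>\<open>X\<close> is then \<open>Y\<close> with one element replaced by
      \<open>e\<close>; swapping these two elements interchanges the sets.\<close>
    case True
    have "X \<inter> Y = X - {e}" using True a by auto
    then have "\<not> card (X \<inter> Y) + 1 < r + 1"
      using a by (auto simp: nsets_def card_Diff_singleton)
    then obtain y where y: "y \<in> Y - X" "insert y (X - {e}) = Y" "insert e (Y - {y}) = X"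
      using nsets_exchange_trivial[OF a(1,2), of e] a by auto
    have "u (insert y (X - {e})) + u (insert e (Y - {y})) \<le> u X + u Y"
      by (simp only: y add.commute order_refl)
    then show ?thesis using a y(1) by blast
  next
    case False
    \<comment> \<open>With \<open>x \<noteq> e\<close> the element \<open>e\<close> remains in the
      first set, as \<open>pu\<close> requires.\<close>
    then obtain x where x: "x \<in> X - {e}" "x \<notin> Y" by blast
    have pX: "p (X - {e}) = u X" using a by (simp add: p_def insert_absorb)
    have "X - {e} \<in> nsets E r" "Y \<in> nsets E (r + 1)"
      using a by (auto simp: nsets_insert_iff[OF e])
    then obtain y where y: "y \<in> Y" "y \<notin> X - {e}"
      "p (insert y (X - {e} - {x})) + u (insert x (Y - {y})) \<le> p (X - {e}) + u Y"
      using exchangeD[OF pu, of "X - {e}" Y x] x a by (auto simp: pX)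
    moreover have "insert e (insert y (X - {e} - {x})) = insert y (X - {x})" using x a by auto
    ultimately have "u (insert y (X - {x})) + u (insert x (Y - {y})) \<le> u X + u Y"
      by (simp only: pX) (simp only: p_def)
    then show ?thesis using x y a by blast
  qed
  have "weak_exchange ?E (r + 1) u" unfolding weak_exchange_def
  proof (intro ballI impI)
    fix X Y assume a: "X \<in> nsets ?E (r + 1)" "Y \<in> nsets ?E (r + 1)" "X \<noteq> Y" "u X \<noteq> \<infinity>" "u Y \<noteq> \<infinity>"
    have "\<not> X \<subseteq> Y" using a by (metis (mono_tags, lifting) card_subset_eq mem_Collect_eq nsets_def)
    then obtain x where x: "x \<in> X" "x \<notin> Y" by blast
    consider "e \<in> X" "e \<in> Y" | "e \<in> X" "e \<notin> Y" | "e \<notin> X" "e \<in> Y" | "e \<notin> X" "e \<notin> Y" by blast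
    then show "?P X Y"
    proof cases
      case 1
      have pX: "p (X - {e}) = u X" "p (Y - {e}) = u Y" using 1 by (simp_all add: p_def insert_absorb)
      have "X - {e} \<in> nsets E r" "Y - {e} \<in> nsets E r"
        using a 1 by (auto simp: nsets_insert_iff[OF e])
      then obtain y where y: "y \<in> Y - {e}" "y \<notin> X - {e}"
        "p (insert y (X - {e} - {x})) + p (insert x (Y - {e} - {y})) \<le> p (X - {e}) + p (Y - {e})"
        using exchangeD[OF pp, of "X - {e}" "Y - {e}" x] x a 1 by (auto simp: pX)
      moreover have "insert e (insert y (X - {e} - {x})) = insert y (X - {x})"
        "insert e (insert x (Y - {e} - {y})) = insert x (Y - {y})" using x y 1 by auto
      ultimately have "u (insert y (X - {x})) + u (insert x (Y - {y})) \<le> u X + u Y"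
        by (simp only: pX) (simp only: p_def)
      then show ?thesis using x y by blast
    next
      case 2
      then show ?thesis using mixed a by blast
    next
      case 3
      then show ?thesis using mixed sym a by blast
    next
      case 4
      then have "X \<in> nsets E (r + 1)" "Y \<in> nsets E (r + 1)"
        using a by (auto simp: nsets_insert_iff[OF e])
      then show ?thesis using uu x a unfolding exchange_def by blast
    qed
  qed
  then show "exchange ?E (r + 1) (r + 1) u u"
    using trop by (rule exchange_of_weak_exchange)
qed

lemma grassmann_pluecker_iff_parts:
  assumes "u \<in> tvec (nsets {0..n} (r + 1))"
  shows "grassmann_pluecker {0..n} (r + 1) u \<longleftrightarrow>
    grassmann_pluecker {1..n} r (with0_part n r u) \<and>
    grassmann_pluecker {1..n} (r + 1) (without0_part n r u) \<and>
    incidence_pluecker {1..n} r (r + 1) (with0_part n r u) (without0_part n r u)"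
proof -
  have E: "{0..n} = insert 0 {1..n}" by auto
  have "exchange {1..n} r r (with0_part n r u) (with0_part n r u) \<longleftrightarrow>
      exchange {1..n} r r (\<lambda>A. u (insert 0 A)) (\<lambda>A. u (insert 0 A))"
    "exchange {1..n} (r + 1) (r + 1) (without0_part n r u) (without0_part n r u) \<longleftrightarrow>
      exchange {1..n} (r + 1) (r + 1) u u"
    "exchange {1..n} r (r + 1) (with0_part n r u) (without0_part n r u) \<longleftrightarrow>
      exchange {1..n} r (r + 1) (\<lambda>A. u (insert 0 A)) u"
    by (rule exchange_cong; simp add: with0_part_def without0_part_def)+
  moreover have "u X \<noteq> -\<infinity>" if "X \<in> nsets (insert 0 {1..n}) (r + 1)" for X
    using assms that unfolding E tvec_def trop_def by auto
  ultimately show ?thesis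
    unfolding grassmann_pluecker_iff_exchange incidence_pluecker_iff_exchange
    using exchange_insert_iff[of 0 "{1..n}" r u] by (simp add: E)
qed

section \<open>Tropical combinations and their two parts\<close>

text \<open>The two extended vectors have disjoint supports: at each index one summand is
  \<infinity>, so the minimum is the other.\<close>

lemma trop_comb_apply:
  "trop_comb n r a \<mu>' b \<mu> = (\<lambda>I\<in>nsets {0..n} (r + 1).
     if 0 \<in> I then ereal a + \<mu>' (I - {0}) else ereal b + \<mu> I)"
  by (auto simp: trop_comb_def Let_def tplus_def tscale_def extend_with0_def extend_without0_def
      fun_eq_iff restrict_def)

lemma nsets_0_iff:
  "X \<in> nsets {0..n::nat} (r + 1) \<longleftrightarrow>
    (if 0 \<in> X then X - {0} \<in> nsets {1..n} r else X \<in> nsets {1..n} (r + 1))"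
proof -
  have "{0..n} = insert 0 {1..n}" by auto
  then show ?thesis using nsets_insert_iff[of 0 "{1..n}" X r] by simp
qed

lemma trop_comb_tscale:
  "trop_comb n r (a + t) \<mu>' (b + t) \<mu> = tscale (nsets {0..n} (r + 1)) t (trop_comb n r a \<mu>' b \<mu>)"
proof -
  have "ereal (c + t) + x = ereal t + (ereal c + x)" for c x
    by (cases x) auto
  then show ?thesis
    by (simp add: trop_comb_apply tscale_def restrict_def fun_eq_iff del: plus_ereal.simps)
qed

lemma with0_part_trop_comb:
  "with0_part n r (trop_comb n r a \<mu>' b \<mu>) = tscale (nsets {1..n} r) a \<mu>'"
proof -
  have "insert 0 I - {0} = I" if "I \<in> nsets {1..n} r" for I :: "nat set"
    using that by (auto simp: nsets_def)
  then show ?thesis using insert0_nsets[of _ n r]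
    by (auto simp: with0_part_def trop_comb_apply tscale_def fun_eq_iff restrict_def)
qed

lemma without0_part_trop_comb:
  "without0_part n r (trop_comb n r a \<mu>' b \<mu>) = tscale (nsets {1..n} (r + 1)) b \<mu>"
proof -
  have "0 \<notin> I" if "I \<in> nsets {1..n} (r + 1)" for I :: "nat set"
    using that by (auto simp: nsets_def)
  then show ?thesis using nsets_1_subset_0[of _ n "r + 1"]
    by (auto simp: without0_part_def trop_comb_apply tscale_def fun_eq_iff restrict_def)
qed

lemma trop_comb_of_parts:
  assumes "u \<in> tvec (nsets {0..n} (r + 1))"
    and "with0_part n r u = tscale (nsets {1..n} r) a \<mu>'"
    and "without0_part n r u = tscale (nsets {1..n} (r + 1)) b \<mu>"
  shows "u = trop_comb n r a \<mu>' b \<mu>"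
proof
  fix X :: "nat set"
  show "u X = trop_comb n r a \<mu>' b \<mu> X"
  proof (cases "X \<in> nsets {0..n} (r + 1)")
    case True
    show ?thesis
    proof (cases "0 \<in> X")
      case z: True
      then have X: "X - {0} \<in> nsets {1..n} r" using True unfolding nsets_0_iff by simp
      have "u X = with0_part n r u (X - {0})"
        using X z by (simp add: with0_part_def insert_absorb)
      then show ?thesis using True z X assms(2) by (simp add: trop_comb_apply tscale_def)
    next
      case z: False
      then have X: "X \<in> nsets {1..n} (r + 1)" using True unfolding nsets_0_iff by simp
      then have "u X = without0_part n r u X" by (simp add: without0_part_def)
      then show ?thesis using True z X assms(3) by (simp add: trop_comb_apply tscale_def)
    qed
  next
    case False
    \<comment> \<open>Outside the index set both sides are \<open>undefined\<close>, as vectors are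
      extensional.\<close>
    then show ?thesis using PiE_arb[of u _ _ X] assms(1) unfolding tvec_def
      by (simp add: trop_comb_apply)
  qed
qed

lemma tpoints_finite_entry:
  assumes "u \<in> tpoints S"
  obtains I where "I \<in> S" "u I \<noteq> \<infinity>" "u I \<noteq> -\<infinity>"
proof -
  have "u \<in> S \<rightarrow>\<^sub>E trop" "u \<noteq> tinf S" using assms by (auto simp: tpoints_def tvec_def)
  then have "\<exists>I\<in>S. u I \<noteq> \<infinity>"
    by (auto simp: tinf_def fun_eq_iff PiE_iff extensional_def restrict_def split: if_splits)
  with \<open>u \<in> S \<rightarrow>\<^sub>E trop\<close> show ?thesis using that by (auto simp: trop_def)
qed

lemma tscale_in_tpoints:
  assumes "u \<in> tpoints S"
  shows "tscale S c u \<in> tpoints S"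
proof -
  have "ereal c + x \<in> trop" if "x \<in> trop" for x using that by (cases x) (auto simp: trop_def)
  then have "tscale S c u \<in> tvec S" using assms by (auto simp: tpoints_def tvec_def tscale_def)
  moreover obtain I where "I \<in> S" "u I \<noteq> \<infinity>" using tpoints_finite_entry[OF assms] by blast
  then have "tscale S c u I \<noteq> tinf S I" by (auto simp: tscale_def tinf_def)
  ultimately show ?thesis by (auto simp: tpoints_def)
qed

text \<open>Any finite entry reveals the constant, and an element of \<open>tpoints S\<close> has
  one.\<close>

lemma tscale_cancel:
  assumes "u \<in> tpoints S" "tscale S a u = tscale S b u"
  shows "a = b"
proof -
  obtain I where I: "I \<in> S" "u I \<noteq> \<infinity>" "u I \<noteq> -\<infinity>" using tpoints_finite_entry[OF assms(1)] .
  have "ereal a + u I = ereal b + u I" using fun_cong[OF assms(2), of I] I by (simp add: tscale_def)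
  then show ?thesis using I by (cases "u I") auto
qed

lemma trop_comb_in_tpoints:
  assumes "\<mu>' \<in> tpoints (nsets {1..n} r)" "\<mu> \<in> tpoints (nsets {1..n} (r + 1))"
  shows "trop_comb n r a \<mu>' b \<mu> \<in> tpoints (nsets {0..n} (r + 1))"
    and "\<exists>I\<in>nsets {0..n} (r + 1). 0 \<in> I \<and> trop_comb n r a \<mu>' b \<mu> I \<noteq> \<infinity>"
    and "\<exists>J\<in>nsets {0..n} (r + 1). 0 \<notin> J \<and> trop_comb n r a \<mu>' b \<mu> J \<noteq> \<infinity>"
proof -
  let ?S = "nsets {0..n} (r + 1)" and ?w = "trop_comb n r a \<mu>' b \<mu>"
  obtain I where I: "I \<in> nsets {1..n} r" "\<mu>' I \<noteq> \<infinity>" using tpoints_finite_entry[OF assms(1)] by blast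
  have "0 \<notin> I" using I by (auto simp: nsets_def)
  then have 1: "insert 0 I \<in> ?S \<and> 0 \<in> insert 0 I \<and> ?w (insert 0 I) \<noteq> \<infinity>"
    using I insert0_nsets[OF I(1)] by (simp add: trop_comb_apply)
  then show ex: "\<exists>I\<in>?S. 0 \<in> I \<and> ?w I \<noteq> \<infinity>" by blast
  obtain J where J: "J \<in> nsets {1..n} (r + 1)" "\<mu> J \<noteq> \<infinity>" using tpoints_finite_entry[OF assms(2)] by blast
  then have "0 \<notin> J" by (auto simp: nsets_def)
  then have "J \<in> ?S \<and> 0 \<notin> J \<and> ?w J \<noteq> \<infinity>"
    using J nsets_1_subset_0[OF J(1)] by (simp add: trop_comb_apply)
  then show "\<exists>J\<in>?S. 0 \<notin> J \<and> ?w J \<noteq> \<infinity>" by blast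
  have t: "ereal c + x \<in> trop" if "x \<in> trop" for c x using that by (cases x) (auto simp: trop_def)
  have "?w X \<in> trop" if "X \<in> ?S" for X
    using that nsets_0_iff[of X n r] assms
    by (auto simp: trop_comb_apply tpoints_def tvec_def intro!: t split: if_splits)
  then have "?w \<in> tvec ?S" by (auto simp: tvec_def trop_comb_apply)
  moreover have "?w \<noteq> tinf ?S" using ex by (auto simp: tinf_def)
  ultimately show "?w \<in> tpoints ?S" by (simp add: tpoints_def)
qed

section \<open>The projection, its image and its fibres\<close>

lemma tclass_tscale:
  assumes "u \<in> tpoints S"
  shows "tclass S (tscale S c u) = tclass S u"
  using tclass_eq_iff[OF assms tscale_in_tpoints[OF assms]] by auto

lemma proj_pi_trop_comb:
  assumes "\<mu>' \<in> tpoints (nsets {1..n} r)" "\<mu> \<in> tpoints (nsets {1..n} (r + 1))"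
  shows "proj_pi n r (tclass (nsets {0..n} (r + 1)) (trop_comb n r a \<mu>' b \<mu>)) =
    (tclass (nsets {1..n} r) \<mu>', tclass (nsets {1..n} (r + 1)) \<mu>)"
  unfolding proj_pi_tclass[OF trop_comb_in_tpoints[OF assms]]
    with0_part_trop_comb without0_part_trop_comb
  using assms by (simp add: tclass_tscale)

lemma tclass_trop_comb_in_Omega:
  assumes "\<mu>' \<in> tpoints (nsets {1..n} r)" "\<mu> \<in> tpoints (nsets {1..n} (r + 1))"
  shows "tclass (nsets {0..n} (r + 1)) (trop_comb n r a \<mu>' b \<mu>) \<in> Omega n r"
  unfolding Omega_def using trop_comb_in_tpoints[OF assms, of a b] by blast

lemma OmegaE:
  assumes "U \<in> Omega n r"
  obtains u where "U = tclass (nsets {0..n} (r + 1)) u" "u \<in> tpoints (nsets {0..n} (r + 1))"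
    "proj_pi n r U = (tclass (nsets {1..n} r) (with0_part n r u),
       tclass (nsets {1..n} (r + 1)) (without0_part n r u))"
    "with0_part n r u \<in> tpoints (nsets {1..n} r)"
    "without0_part n r u \<in> tpoints (nsets {1..n} (r + 1))"
proof -
  obtain u where U: "U = tclass (nsets {0..n} (r + 1)) u"
    and u: "u \<in> tpoints (nsets {0..n} (r + 1))"
      "\<exists>I\<in>nsets {0..n} (r + 1). 0 \<in> I \<and> u I \<noteq> \<infinity>"
      "\<exists>J\<in>nsets {0..n} (r + 1). 0 \<notin> J \<and> u J \<noteq> \<infinity>"
    using assms unfolding Omega_def by blast
  show ?thesis
    using that[OF U u(1)] proj_pi_tclass[OF u] parts_in_tpoints[OF u] unfolding U by blast
qed

text \<open>Both memberships can be tested on representatives, where they are the two sides of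
  \<open>grassmann_pluecker_iff_parts\<close>. Within \<open>Omega n r\<close> the Dressian is thus
  the full preimage of the flag Dressian.\<close>

lemma Dressian_iff_proj_pi_in_FlagDressian:
  assumes "U \<in> Omega n r"
  shows "U \<in> Dressian {0..n} (r + 1) \<longleftrightarrow> proj_pi n r U \<in> FlagDressian {1..n} r (r + 1)"
proof -
  obtain u where U: "U = tclass (nsets {0..n} (r + 1)) u" and u: "u \<in> tpoints (nsets {0..n} (r + 1))"
    and pr: "proj_pi n r U = (tclass (nsets {1..n} r) (with0_part n r u),
       tclass (nsets {1..n} (r + 1)) (without0_part n r u))"
    and parts: "with0_part n r u \<in> tpoints (nsets {1..n} r)"
      "without0_part n r u \<in> tpoints (nsets {1..n} (r + 1))"
    using OmegaE[OF assms] .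
  have "u \<in> tvec (nsets {0..n} (r + 1))" using u by (simp add: tpoints_def)
  then show ?thesis
    unfolding pr unfolding U tclass_in_Dressian_iff[OF u] tclass_in_FlagDressian_iff[OF parts le_add1]
    by (rule grassmann_pluecker_iff_parts)
qed

text \<open>Every combination projects to the given point, hence lies in the Dressian by the
  preimage description. Conversely, equality of the projective classes gives one constant for each
  part, and these are \<open>a\<close> and \<open>b\<close>.\<close>

lemma fiber_eq:
  assumes \<mu>: "\<mu>' \<in> tpoints (nsets {1..n} r)" "\<mu> \<in> tpoints (nsets {1..n} (r + 1))"
    and fl: "(tclass (nsets {1..n} r) \<mu>', tclass (nsets {1..n} (r + 1)) \<mu>) \<in> FlagDressian {1..n} r (r + 1)"
  shows "{U \<in> Omega n r \<inter> Dressian {0..n} (r + 1).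
      proj_pi n r U = (tclass (nsets {1..n} r) \<mu>', tclass (nsets {1..n} (r + 1)) \<mu>)} =
    {tclass (nsets {0..n} (r + 1)) (trop_comb n r a \<mu>' b \<mu>) | a b. True}" (is "?F = ?C")
proof
  show "?C \<subseteq> ?F"
    using tclass_trop_comb_in_Omega[OF \<mu>] proj_pi_trop_comb[OF \<mu>] fl
      Dressian_iff_proj_pi_in_FlagDressian by auto
  show "?F \<subseteq> ?C"
  proof
    fix U assume "U \<in> ?F"
    then have "U \<in> Omega n r" and eq: "proj_pi n r U =
        (tclass (nsets {1..n} r) \<mu>', tclass (nsets {1..n} (r + 1)) \<mu>)" by auto
    then obtain u where U: "U = tclass (nsets {0..n} (r + 1)) u" and u: "u \<in> tpoints (nsets {0..n} (r + 1))"
      and pr: "proj_pi n r U = (tclass (nsets {1..n} r) (with0_part n r u),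
         tclass (nsets {1..n} (r + 1)) (without0_part n r u))"
      and parts: "with0_part n r u \<in> tpoints (nsets {1..n} r)"
        "without0_part n r u \<in> tpoints (nsets {1..n} (r + 1))"
      using OmegaE by metis
    have "\<exists>a. with0_part n r u = tscale (nsets {1..n} r) a \<mu>'"
      "\<exists>b. without0_part n r u = tscale (nsets {1..n} (r + 1)) b \<mu>"
      using pr eq tclass_eq_iff[OF \<mu>(1) parts(1)] tclass_eq_iff[OF \<mu>(2) parts(2)] by auto
    then obtain a b where "with0_part n r u = tscale (nsets {1..n} r) a \<mu>'"
      "without0_part n r u = tscale (nsets {1..n} (r + 1)) b \<mu>" by blast
    then have "u = trop_comb n r a \<mu>' b \<mu>"
      using u by (intro trop_comb_of_parts) (auto simp: tpoints_def)
    then show "U \<in> ?C" using U by blast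
  qed
qed

section \<open>Parametrising a fibre by R^2/R(1,1)\<close>

text \<open>Adding \<open>t\<close> to both coefficients rescales the whole vector by
  \<open>t\<close>; conversely, the two parts recover the coefficients through
  \<open>tscale_cancel\<close>.\<close>

lemma tclass_trop_comb_eq_iff:
  assumes \<mu>: "\<mu>' \<in> tpoints (nsets {1..n} r)" "\<mu> \<in> tpoints (nsets {1..n} (r + 1))"
  shows "tclass (nsets {0..n} (r + 1)) (trop_comb n r a \<mu>' b \<mu>) =
      tclass (nsets {0..n} (r + 1)) (trop_comb n r a' \<mu>' b' \<mu>) \<longleftrightarrow> ((a, b), (a', b')) \<in> diag_rel"
proof -
  let ?S = "nsets {0..n} (r + 1)"
  have "trop_comb n r a' \<mu>' b' \<mu> = tscale ?S t (trop_comb n r a \<mu>' b \<mu>) \<longleftrightarrow> a' = a + t \<and> b' = b + t"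
    for t
  proof
    assume "trop_comb n r a' \<mu>' b' \<mu> = tscale ?S t (trop_comb n r a \<mu>' b \<mu>)"
    then have eq: "trop_comb n r a' \<mu>' b' \<mu> = trop_comb n r (a + t) \<mu>' (b + t) \<mu>"
      by (simp only: trop_comb_tscale)
    have "a' = a + t"
      using arg_cong[OF eq, of "with0_part n r"] tscale_cancel[OF \<mu>(1)]
      by (simp only: with0_part_trop_comb)
    moreover have "b' = b + t"
      using arg_cong[OF eq, of "without0_part n r"] tscale_cancel[OF \<mu>(2)]
      by (simp only: without0_part_trop_comb)
    ultimately show "a' = a + t \<and> b' = b + t" ..
  qed (simp only: trop_comb_tscale)
  then show ?thesis
    unfolding tclass_eq_iff[OF trop_comb_in_tpoints(1)[OF \<mu>] trop_comb_in_tpoints(1)[OF \<mu>]]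
    by (simp add: diag_rel_def)
qed

text \<open>This factors \<open>g\<close> through its kernel relation \<open>R\<close>;
  \<open>the_elem\<close> is meaningful because \<open>g\<close> is constant on each class.\<close>

lemma bij_betw_quotient_the_elem:
  assumes "equiv UNIV R" and "\<And>x y. g x = g y \<longleftrightarrow> (x, y) \<in> R"
  defines "f \<equiv> \<lambda>Q. the_elem (g ` Q)"
  shows "bij_betw f (UNIV // R) (range g)" and "f (R `` {x}) = g x"
proof -
  have f: "f (R `` {x}) = g x" for x
  proof -
    have "g ` (R `` {x}) = (\<lambda>_. g x) ` (R `` {x})"
    proof (rule image_cong)
      fix y assume "y \<in> R `` {x}"
      then show "g y = g x" using assms(2)[of x y] by simp
    qed simp
    also have "\<dots> = {g x}"
      by (rule image_constant[of x]) (use assms(2)[of x x] in simp)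
    finally have "g ` (R `` {x}) = {g x}" .
    then show ?thesis by (simp add: f_def)
  qed
  then show "f (R `` {x}) = g x" .
  have "inj_on f (UNIV // R)"
    by (rule inj_onI) (metis f assms(1,2) equiv_class_eq quotientE)
  moreover have "f ` (UNIV // R) = range g"
    using f by (auto simp: quotient_def image_UN)
  ultimately show "bij_betw f (UNIV // R) (range g)" by (simp add: bij_betw_def)
qed

theorem theorem5p2:
  fixes r n :: nat
  assumes "r \<le> n"
  shows "proj_pi n r ` (Omega n r \<inter> Dressian {0..n} (r + 1)) = FlagDressian {1..n} r (r + 1) \<and>
    (\<forall>\<mu>' \<in> tpoints (nsets {1..n} r). \<forall>\<mu> \<in> tpoints (nsets {1..n} (r + 1)).
      (tclass (nsets {1..n} r) \<mu>', tclass (nsets {1..n} (r + 1)) \<mu>) \<in> FlagDressian {1..n} r (r + 1) \<longrightarrow>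
      (let fiber = {U \<in> Omega n r \<inter> Dressian {0..n} (r + 1).
             proj_pi n r U = (tclass (nsets {1..n} r) \<mu>', tclass (nsets {1..n} (r + 1)) \<mu>)};
           cls = (\<lambda>a b. tclass (nsets {0..n} (r + 1)) (trop_comb n r a \<mu>' b \<mu>))
       in fiber = {cls a b | a b :: real. True} \<and>
          (\<forall>a b :: real. cls a b \<in> Dressian {0..n} (r + 1)) \<and>
          (\<exists>f. bij_betw f (UNIV // diag_rel) fiber \<and>
               (\<forall>a b :: real. f (diag_rel `` {(a, b)}) = cls a b))))"
proof (intro conjI ballI impI)
  show "proj_pi n r ` (Omega n r \<inter> Dressian {0..n} (r + 1)) = FlagDressian {1..n} r (r + 1)"
  proof
    show "proj_pi n r ` (Omega n r \<inter> Dressian {0..n} (r + 1)) \<subseteq> FlagDressian {1..n} r (r + 1)"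
      using Dressian_iff_proj_pi_in_FlagDressian by blast
    show "FlagDressian {1..n} r (r + 1) \<subseteq> proj_pi n r ` (Omega n r \<inter> Dressian {0..n} (r + 1))"
    proof
      fix F assume F: "F \<in> FlagDressian {1..n} r (r + 1)"
      then obtain \<mu>' \<mu> where eq: "F = (tclass (nsets {1..n} r) \<mu>', tclass (nsets {1..n} (r + 1)) \<mu>)"
        and \<mu>: "\<mu>' \<in> tpoints (nsets {1..n} r)" "\<mu> \<in> tpoints (nsets {1..n} (r + 1))"
        unfolding FlagDressian_def by blast
      \<comment> \<open>Any two real coefficients give a preimage; both are taken to be 0.\<close>
      let ?U = "tclass (nsets {0..n} (r + 1)) (trop_comb n r 0 \<mu>' 0 \<mu>)"
      have U: "F = proj_pi n r ?U" "?U \<in> Omega n r"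
        using proj_pi_trop_comb[OF \<mu>] tclass_trop_comb_in_Omega[OF \<mu>] eq by auto
      then have "?U \<in> Dressian {0..n} (r + 1)"
        using F Dressian_iff_proj_pi_in_FlagDressian by metis
      then show "F \<in> proj_pi n r ` (Omega n r \<inter> Dressian {0..n} (r + 1))"
        using U by blast
    qed
  qed
next
  fix \<mu>' \<mu>
  assume \<mu>: "\<mu>' \<in> tpoints (nsets {1..n} r)" "\<mu> \<in> tpoints (nsets {1..n} (r + 1))"
    and fl: "(tclass (nsets {1..n} r) \<mu>', tclass (nsets {1..n} (r + 1)) \<mu>) \<in> FlagDressian {1..n} r (r + 1)"
  define cls where "cls = (\<lambda>a b. tclass (nsets {0..n} (r + 1)) (trop_comb n r a \<mu>' b \<mu>))"
  let ?fiber = "{U \<in> Omega n r \<inter> Dressian {0..n} (r + 1).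
      proj_pi n r U = (tclass (nsets {1..n} r) \<mu>', tclass (nsets {1..n} (r + 1)) \<mu>)}"
  have fiber: "?fiber = {cls a b | a b. True}"
    unfolding cls_def by (rule fiber_eq[OF \<mu> fl])
  moreover have "\<forall>a b. cls a b \<in> Dressian {0..n} (r + 1)"
    using fiber by blast
  moreover have "\<exists>f. bij_betw f (UNIV // diag_rel) ?fiber \<and>
      (\<forall>a b. f (diag_rel `` {(a, b)}) = cls a b)"
  proof -
    let ?g = "\<lambda>(a, b). cls a b"
    have g: "?g x = ?g y \<longleftrightarrow> (x, y) \<in> diag_rel" for x y
      using tclass_trop_comb_eq_iff[OF \<mu>] by (cases x; cases y) (simp add: cls_def)
    have "range ?g = ?fiber" unfolding fiber by force
    then show ?thesis
      using bij_betw_quotient_the_elem[OF equiv_diag_rel g] by (metis (no_types, lifting) case_prod_conv)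
  qed
  ultimately show "let fiber = ?fiber;
           cls = (\<lambda>a b. tclass (nsets {0..n} (r + 1)) (trop_comb n r a \<mu>' b \<mu>))
       in fiber = {cls a b | a b :: real. True} \<and>
          (\<forall>a b :: real. cls a b \<in> Dressian {0..n} (r + 1)) \<and>
          (\<exists>f. bij_betw f (UNIV // diag_rel) fiber \<and>
               (\<forall>a b :: real. f (diag_rel `` {(a, b)}) = cls a b))"
    unfolding Let_def cls_def by blast
qed

end
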